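(* Let $X_1,X_2,\ldots$ be independent and identically distributed standard exponential random variables. For any positive integer $k\le 4$, any $n\in\mathbb{N}$, and any real numbers $a_1,\ldots,a_n\ge 0$ with $\sum_{i=1}^n a_i^2=1$, $$\mathbb{E}X_1^k\ \le\ \mathbb{E}\Big(\sum_{j=1}^n a_jX_j\Big)^k\ \le\ \mathbb{E}\Big(\frac{X_1+\cdots+X_n}{\sqrt n}\Big)^k.$$
   Context: A standard exponential random variable has density $e^{-x}\mathbf 1_{x>0}$. *)

theory Defs
  imports "HOL-Probability.Probability"
begin

end

theory Submission
  imports Defs
begin

text \<open>
  Write \<open>S = (\<Sum>i\<in>A. a i * X i)\<close> and let \<open>p r = (\<Sum>i\<in>A. a i ^ r)\<close> be the power sums of the weights.
  Because \<open>X i\<close> has \<open>r\<close>-th moment \<open>r!\<close>, the multinomial expansion of the \<open>k\<close>-th moment of \<open>S\<close> is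
  \<open>k!\<close> times the complete homogeneous symmetric polynomial of degree \<open>k\<close> in the weights.
  For \<open>k \<le> 4\<close> this is an explicit polynomial in \<open>p 1, \<dots>, p 4\<close> (lemma \<open>moments_exponential_sum\<close>),
  so the claim becomes two inequalities between power sums of nonnegative numbers with \<open>p 2 = 1\<close>.

  The lower bounds compare with a single weight \<open>1\<close>, where all power sums equal \<open>1\<close>. Here
  \<open>p 1 \<ge> 1\<close>, and while \<open>p 3\<close> and \<open>p 4\<close> may drop below \<open>1\<close>, Cauchy-Schwarz controls the loss:
  \<open>p 1 * p 3 \<ge> 1\<close> gives \<open>p 3 \<ge> 2 - p 1\<close>, and then \<open>p 4 \<ge> 2 * p 3 - 1 \<ge> 3 - 2 * p 1\<close>.
  These bounds are equalities at \<open>p 1 = 1\<close>, and for larger \<open>p 1\<close> the growth of its powers outweighs them.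

  The upper bounds compare with \<open>n\<close> equal weights. There \<open>p 1\<close> attains its maximum \<open>\<surd>n\<close>, but
  \<open>p 3\<close> and \<open>p 4\<close> are minimal, so their excess over the equal-weight value has to be bounded by
  the deficit of \<open>p 1\<close>. For \<open>k = 3\<close> the excess of \<open>p 3\<close> is at most a multiple of \<open>\<surd>n - p 1\<close>
  (lemma \<open>power_sum_3_le\<close>). For \<open>k = 4\<close>,
  \<open>n - (p 1)\<^sup>2\<close>, \<open>p 1 * p 3 - 1\<close> and \<open>n * p 4 - 1\<close> are all written as double sums of multiples of
  \<open>(a i - a j)\<^sup>2\<close>, and the inequality then holds for every pair \<open>i, j\<close> (lemma \<open>fourth_moment_pair_bound\<close>).
\<close>

section \<open>Power sums\<close>

definition power_sum :: "'i set \<Rightarrow> ('i \<Rightarrow> real) \<Rightarrow> nat \<Rightarrow> real" where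
  "power_sum A a r = (\<Sum>i\<in>A. a i ^ r)"

lemma power_sum_insert [simp]:
  "finite A \<Longrightarrow> j \<notin> A \<Longrightarrow> power_sum (insert j A) a r = a j ^ r + power_sum A a r"
  by (simp add: power_sum_def)

lemma power_sum_empty [simp]: "power_sum {} a r = 0"
  by (simp add: power_sum_def)

lemma power_sum_mult:
  "power_sum A a r * power_sum A a s = (\<Sum>i\<in>A. \<Sum>j\<in>A. a i ^ r * a j ^ s)"
  by (simp add: power_sum_def sum_product)

lemma pair_sum_diff_squared:
  "(\<Sum>i\<in>A. \<Sum>j\<in>A. (a i - a j)\<^sup>2)
     = 2 * (real (card A) * power_sum A a 2 - (power_sum A a 1)\<^sup>2)"
proof -
  have "(\<Sum>i\<in>A. \<Sum>j\<in>A. (a i - a j)\<^sup>2)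
      = (\<Sum>i\<in>A. \<Sum>j\<in>A. a i ^ 2 + a j ^ 2 - 2 * (a i ^ 1 * a j ^ 1))"
    by (intro sum.cong refl) (simp add: power2_diff)
  also have "\<dots> = 2 * real (card A) * power_sum A a 2 - 2 * (power_sum A a 1 * power_sum A a 1)"
    unfolding power_sum_mult
    by (simp only: sum.distrib sum_subtractf sum_distrib_left[symmetric] sum_constant)
       (simp add: power_sum_def)
  finally show ?thesis
    by (simp add: power2_eq_square algebra_simps)
qed

lemma pair_sum_weighted_diff_squared:
  "(\<Sum>i\<in>A. \<Sum>j\<in>A. a i * a j * (a i - a j)\<^sup>2)
     = 2 * (power_sum A a 1 * power_sum A a 3 - (power_sum A a 2)\<^sup>2)"
proof -
  have "(\<Sum>i\<in>A. \<Sum>j\<in>A. a i * a j * (a i - a j)\<^sup>2)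
      = (\<Sum>i\<in>A. \<Sum>j\<in>A. a i ^ 1 * a j ^ 3 + a i ^ 3 * a j ^ 1 - 2 * (a i ^ 2 * a j ^ 2))"
    by (intro sum.cong refl) (simp add: power2_eq_square power3_eq_cube algebra_simps)
  also have "\<dots> = power_sum A a 1 * power_sum A a 3 + power_sum A a 3 * power_sum A a 1
      - 2 * (power_sum A a 2 * power_sum A a 2)"
    unfolding power_sum_mult
    by (simp only: sum.distrib sum_subtractf sum_distrib_left[symmetric])
  finally show ?thesis
    by (simp add: power2_eq_square algebra_simps)
qed

section \<open>Moments of weighted sums of exponentials\<close>

context prob_space
begin

lemma
  fixes S X :: "'a \<Rightarrow> real"
  assumes indep: "indep_var borel X borel S"
    and X: "distributed M lborel X (exponential_density 1)"
    and S: "\<And>r. integrable M (\<lambda>\<omega>. S \<omega> ^ r)"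
  shows integrable_power_add_exponential: "integrable M (\<lambda>\<omega>. (c * X \<omega> + S \<omega>) ^ k)"
    and expectation_power_add_exponential: "expectation (\<lambda>\<omega>. (c * X \<omega> + S \<omega>) ^ k)
      = (\<Sum>r\<le>k. real (k choose r) * c ^ r * fact r * expectation (\<lambda>\<omega>. S \<omega> ^ (k - r)))"
proof -
  have binom: "(c * X \<omega> + S \<omega>) ^ k
      = (\<Sum>r\<le>k. real (k choose r) * c ^ r * (X \<omega> ^ r * S \<omega> ^ (k - r)))" for \<omega>
    by (simp add: binomial_ring power_mult_distrib mult_ac)
  have ind: "indep_var borel (\<lambda>\<omega>. X \<omega> ^ r) borel (\<lambda>\<omega>. S \<omega> ^ s)" for r s
    using indep_var_compose[OF indep, of "\<lambda>x. x ^ r" borel "\<lambda>x. x ^ s" borel]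
    by (simp add: comp_def)
  have X_int: "integrable M (\<lambda>\<omega>. X \<omega> ^ r)"
    and X_moment: "expectation (\<lambda>\<omega>. X \<omega> ^ r) = fact r" for r
    using erlang_ith_moment_integrable[OF _ X, of r] erlang_ith_moment[OF _ X, of r] by auto
  have int: "integrable M (\<lambda>\<omega>. X \<omega> ^ r * S \<omega> ^ s)" for r s
    by (rule indep_var_integrable[OF ind X_int S])
  have prod: "expectation (\<lambda>\<omega>. X \<omega> ^ r * S \<omega> ^ s) = fact r * expectation (\<lambda>\<omega>. S \<omega> ^ s)" for r s
    using indep_var_lebesgue_integral[OF ind X_int S] X_moment by simp
  show "integrable M (\<lambda>\<omega>. (c * X \<omega> + S \<omega>) ^ k)"
    unfolding binom by (intro Bochner_Integration.integrable_sum integrable_mult_right int)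
  show "expectation (\<lambda>\<omega>. (c * X \<omega> + S \<omega>) ^ k)
      = (\<Sum>r\<le>k. real (k choose r) * c ^ r * fact r * expectation (\<lambda>\<omega>. S \<omega> ^ (k - r)))"
    unfolding binom
    by (subst Bochner_Integration.integral_sum)
       (auto intro!: integrable_mult_right int simp: prod mult_ac)
qed

text \<open>
  By \<open>expectation_power_add_exponential\<close>, the first four moments of a sum with one more summand
  \<open>a j * X j\<close> are polynomials in \<open>a j\<close> and the earlier moments. Their expressions in the power sums
  are Newton's identities for \<open>k!\<close> times the complete homogeneous symmetric polynomials. Integrability of
  all powers is carried along to factorise the expectations.
\<close>
lemma moments_exponential_sum:
  fixes X :: "'i \<Rightarrow> 'a \<Rightarrow> real" and a :: "'i \<Rightarrow> real"
  assumes "finite A" "indep_vars (\<lambda>_. borel) X A"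
    and "\<And>i. i \<in> A \<Longrightarrow> distributed M lborel (X i) (exponential_density 1)"
  defines "p \<equiv> power_sum A a" and "S \<equiv> \<lambda>\<omega>. \<Sum>i\<in>A. a i * X i \<omega>"
  shows "(\<forall>r. integrable M (\<lambda>\<omega>. S \<omega> ^ r))
    \<and> expectation (\<lambda>\<omega>. S \<omega> ^ 1) = p 1
    \<and> expectation (\<lambda>\<omega>. S \<omega> ^ 2) = p 1 ^ 2 + p 2
    \<and> expectation (\<lambda>\<omega>. S \<omega> ^ 3) = p 1 ^ 3 + 3 * p 1 * p 2 + 2 * p 3
    \<and> expectation (\<lambda>\<omega>. S \<omega> ^ 4)
        = p 1 ^ 4 + 6 * p 1 ^ 2 * p 2 + 3 * p 2 ^ 2 + 8 * p 1 * p 3 + 6 * p 4"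
  using assms(1-3) unfolding p_def S_def
proof (induction A rule: finite_induct)
  case empty
  then show ?case by (simp add: power_0_left)
next
  case (insert j A)
  let ?S = "\<lambda>\<omega>. \<Sum>i\<in>A. a i * X i \<omega>"
  have "indep_vars (\<lambda>_. borel) X A"
    using insert.prems(1) by (rule indep_vars_subset) auto
  note IH = insert.IH[OF this insert.prems(2)[OF insertI2]]
  \<comment> \<open>Giving \<open>X j\<close> weight \<open>1\<close> keeps it unscaled, so that independence is of \<open>X j\<close> from the weighted sum.\<close>
  have "indep_vars (\<lambda>_. borel) (\<lambda>i \<omega>. (if i = j then 1 else a i) * X i \<omega>) (insert j A)"
    using insert.prems(1) by (rule indep_vars_compose2[where X = X]) auto
  from indep_vars_sum[OF insert.hyps this]
  have "indep_var borel (X j) borel (\<lambda>\<omega>. \<Sum>i\<in>A. (if i = j then 1 else a i) * X i \<omega>)"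
    by simp
  also have "(\<lambda>\<omega>. \<Sum>i\<in>A. (if i = j then 1 else a i) * X i \<omega>) = ?S"
    using insert.hyps by (intro ext sum.cong) auto
  finally have ind: "indep_var borel (X j) borel ?S" .
  have Xj: "distributed M lborel (X j) (exponential_density 1)"
    using insert.prems(2) by simp
  have S: "integrable M (\<lambda>\<omega>. ?S \<omega> ^ r)" for r
    using IH by blast
  note int = integrable_power_add_exponential[OF ind Xj S, of "a j"]
    and moment = expectation_power_add_exponential[OF ind Xj S, of "a j"]
  have sets: "{..2::nat} = {0, 1, 2}" "{..3::nat} = {0, 1, 2, 3}" "{..4::nat} = {0, 1, 2, 3, 4}"
    by auto
  have choose: "3 choose 2 = (3::nat)" "4 choose 2 = (6::nat)" "4 choose 3 = (4::nat)"
    by (simp_all add: numeral_eq_Suc)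
  have IH1: "expectation ?S = power_sum A a 1" using IH by simp
  have "expectation (\<lambda>\<omega>. (a j * X j \<omega> + ?S \<omega>) ^ 1) = a j + power_sum A a 1"
    unfolding moment using IH1 by (simp add: prob_space)
  moreover have "expectation (\<lambda>\<omega>. (a j * X j \<omega> + ?S \<omega>) ^ 2)
      = 2 * a j ^ 2 + 2 * a j * power_sum A a 1 + (power_sum A a 1 ^ 2 + power_sum A a 2)"
    unfolding moment sets using IH IH1 by (simp add: prob_space fact_numeral)
  moreover have "expectation (\<lambda>\<omega>. (a j * X j \<omega> + ?S \<omega>) ^ 3)
      = 6 * a j ^ 3 + 6 * a j ^ 2 * power_sum A a 1
        + 3 * a j * (power_sum A a 1 ^ 2 + power_sum A a 2)
        + (power_sum A a 1 ^ 3 + 3 * power_sum A a 1 * power_sum A a 2 + 2 * power_sum A a 3)"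
    unfolding moment sets using IH IH1 by (simp add: prob_space choose fact_numeral)
  moreover have "expectation (\<lambda>\<omega>. (a j * X j \<omega> + ?S \<omega>) ^ 4)
      = 24 * a j ^ 4 + 24 * a j ^ 3 * power_sum A a 1
        + 12 * a j ^ 2 * (power_sum A a 1 ^ 2 + power_sum A a 2)
        + 4 * a j * (power_sum A a 1 ^ 3 + 3 * power_sum A a 1 * power_sum A a 2 + 2 * power_sum A a 3)
        + (power_sum A a 1 ^ 4 + 6 * power_sum A a 1 ^ 2 * power_sum A a 2 + 3 * power_sum A a 2 ^ 2
           + 8 * power_sum A a 1 * power_sum A a 3 + 6 * power_sum A a 4)"
    unfolding moment sets using IH IH1 by (simp add: prob_space choose fact_numeral)
  ultimately show ?case
    using insert.hyps int
    by (simp add: power2_eq_square power3_eq_cube power4_eq_xxxx algebra_simps)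
qed

end

section \<open>The lower bound\<close>

context
  fixes A :: "'i set" and a :: "'i \<Rightarrow> real"
  assumes fin: "finite A" and nonneg: "\<And>i. i \<in> A \<Longrightarrow> 0 \<le> a i"
    and norm: "power_sum A a 2 = 1"
begin

lemma weight_le_one: "i \<in> A \<Longrightarrow> a i \<le> 1"
proof -
  assume "i \<in> A"
  then have "(a i)\<^sup>2 \<le> 1"
    using norm member_le_sum[of i A "\<lambda>i. (a i)\<^sup>2"] fin by (simp add: power_sum_def)
  then show "a i \<le> 1"
    by (simp add: power_le_one_iff abs_square_le_1)
qed

lemma one_le_power_sum_1: "1 \<le> power_sum A a 1"
proof -
  have "power_sum A a 2 \<le> power_sum A a 1"
    unfolding power_sum_def
    by (intro sum_mono) (simp add: power2_eq_square mult_left_le nonneg weight_le_one)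
  then show ?thesis using norm by simp
qed

text \<open>
  The product bound is the Cauchy-Schwarz inequality for \<open>p 2 = (\<Sum>i\<in>A. a i powr (1/2) * a i powr (3/2))\<close>,
  read off from the double sum without square roots. The linear bound uses \<open>1 / x \<ge> 2 - x\<close>, the tangent at \<open>x = 1\<close>.
\<close>
lemma power_sum_3_ge: "power_sum A a 3 \<ge> 2 - power_sum A a 1"
  and one_le_power_sum_1_times_3: "power_sum A a 1 * power_sum A a 3 \<ge> 1"
proof -
  define p where "p = power_sum A a"
  have "0 \<le> (\<Sum>i\<in>A. \<Sum>j\<in>A. a i * a j * (a i - a j)\<^sup>2)"
    by (intro sum_nonneg mult_nonneg_nonneg nonneg) auto
  then show *: "power_sum A a 1 * power_sum A a 3 \<ge> 1"
    unfolding pair_sum_weighted_diff_squared norm by simp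
  have "0 \<le> (p 1 - 1)\<^sup>2" by simp
  then have "p 1 * (2 - p 1) \<le> p 1 * p 3"
    using * by (simp add: p_def power2_eq_square algebra_simps)
  then show "power_sum A a 3 \<ge> 2 - power_sum A a 1"
    using one_le_power_sum_1 by (simp add: p_def)
qed

lemma power_sum_4_ge: "power_sum A a 4 \<ge> 3 - 2 * power_sum A a 1"
proof -
  \<comment> \<open>Every summand vanishes for weights in \<open>{0, 1}\<close>, so nothing is lost in the extremal case.\<close>
  have "0 \<le> (\<Sum>i\<in>A. ((a i)\<^sup>2 - a i)\<^sup>2)"
    by (intro sum_nonneg) auto
  also have "\<dots> = (\<Sum>i\<in>A. a i ^ 4 + a i ^ 2 - 2 * a i ^ 3)"
    by (intro sum.cong refl) (simp add: power2_eq_square power3_eq_cube power4_eq_xxxx algebra_simps)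
  also have "\<dots> = power_sum A a 4 + 1 - 2 * power_sum A a 3"
    using norm by (simp add: power_sum_def sum.distrib sum_subtractf sum_distrib_left)
  finally show ?thesis
    using power_sum_3_ge by simp
qed

lemma third_moment_ge:
  "power_sum A a 1 ^ 3 + 3 * power_sum A a 1 + 2 * power_sum A a 3 \<ge> 6"
proof -
  have "power_sum A a 1 ^ 3 \<ge> 1" using one_le_power_sum_1 by simp
  then show ?thesis using power_sum_3_ge one_le_power_sum_1 by linarith
qed

lemma fourth_moment_ge:
  "power_sum A a 1 ^ 4 + 6 * power_sum A a 1 ^ 2 + 3
     + 8 * power_sum A a 1 * power_sum A a 3 + 6 * power_sum A a 4 \<ge> 24"
proof -
  define p where "p = power_sum A a"
  have "p 1 ^ 4 \<ge> 1" using one_le_power_sum_1 by (simp add: p_def)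
  moreover have "0 \<le> 6 * (p 1 - 1)\<^sup>2" by simp
  then have "6 * p 1 ^ 2 + 6 * (3 - 2 * p 1) \<ge> 12"
    by (simp add: power2_eq_square algebra_simps)
  ultimately show ?thesis
    using power_sum_4_ge one_le_power_sum_1_times_3 by (simp add: p_def)
qed

section \<open>The upper bound\<close>

lemma card_pos: "1 \<le> card A"
  using norm fin by (cases "A = {}") (auto simp: Suc_le_eq card_gt_0_iff)

lemma power_sum_1_squared_le: "(power_sum A a 1)\<^sup>2 \<le> card A"
proof -
  have "0 \<le> (\<Sum>i\<in>A. \<Sum>j\<in>A. (a i - a j)\<^sup>2)"
    by (intro sum_nonneg) auto
  then show ?thesis unfolding pair_sum_diff_squared norm by simp
qed

lemma power_sum_1_le: "power_sum A a 1 \<le> sqrt (card A)"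
  using power_sum_1_squared_le by (rule real_le_rsqrt)

text \<open>
  With \<open>m = 1 / \<surd>n\<close>, expanding \<open>a i * (a i - m)\<^sup>2\<close> expresses \<open>p 3\<close> through this weighted
  distance to equal weights and \<open>p 1\<close>. The factor \<open>a i \<le> 1\<close> is dropped, and
  \<open>(\<Sum>i\<in>A. (a i - m)\<^sup>2) = 2 - 2 * m * p 1\<close> is itself proportional to the deficit \<open>\<surd>n - p 1\<close>.
\<close>
lemma power_sum_3_le:
  defines "s \<equiv> sqrt (card A)"
  shows "power_sum A a 3 \<le> 1 / s + (s - power_sum A a 1) * (2 / s + 1 / s\<^sup>2)"
proof -
  define p where "p = power_sum A a"
  define m where "m = 1 / s"
  have s: "s \<ge> 1" and m: "s * m = 1" "s\<^sup>2 = card A"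
    using card_pos by (auto simp: s_def m_def)
  have nm: "card A * m\<^sup>2 = 1"
    using m by (metis power_mult_distrib power_one)
  have "p 3 - 2 * m + m\<^sup>2 * p 1 = (\<Sum>i\<in>A. a i * (a i - m)\<^sup>2)"
  proof -
    have "(\<Sum>i\<in>A. a i * (a i - m)\<^sup>2) = (\<Sum>i\<in>A. a i ^ 3 - 2 * m * a i ^ 2 + m\<^sup>2 * a i ^ 1)"
      by (intro sum.cong refl) (simp add: power2_eq_square power3_eq_cube algebra_simps)
    also have "\<dots> = p 3 - 2 * m * p 2 + m\<^sup>2 * p 1"
      by (simp add: p_def power_sum_def sum.distrib sum_subtractf sum_distrib_left)
    finally show ?thesis using norm by (simp add: p_def)
  qed
  also have "\<dots> \<le> (\<Sum>i\<in>A. (a i - m)\<^sup>2)"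
    by (intro sum_mono) (simp add: mult_right_le_one_le mult_left_le_one_le nonneg weight_le_one)
  also have "\<dots> = (\<Sum>i\<in>A. a i ^ 2 - 2 * m * a i ^ 1 + m\<^sup>2)"
    by (intro sum.cong refl) (simp add: power2_eq_square algebra_simps)
  also have "\<dots> = p 2 - 2 * m * p 1 + card A * m\<^sup>2"
    by (simp add: p_def power_sum_def sum.distrib sum_subtractf sum_distrib_left)
  also have "\<dots> = 2 - 2 * m * p 1"
    using norm nm by (simp add: p_def)
  finally have "p 3 \<le> 2 * m + 2 * (s * m) - 2 * m * p 1 - m\<^sup>2 * p 1"
    using m by simp
  moreover have "m\<^sup>2 * s = m" using m(1) by (metis mult.assoc mult.commute mult_1_right power2_eq_square)
  ultimately have "p 3 \<le> m + (s - p 1) * (2 * m + m\<^sup>2)"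
    by (simp add: algebra_simps)
  then show ?thesis by (simp add: p_def m_def power_one_over)
qed

text \<open>
  The excess of \<open>2 * p 3\<close> is at most \<open>6 * (s - p 1)\<close> since \<open>s \<ge> 1\<close>, and the terms
  \<open>p 1 ^ 3 + 3 * p 1\<close> fall short by at least \<open>6 * (s - p 1)\<close> since \<open>p 1 \<ge> 1\<close>.
\<close>
lemma third_moment_le:
  defines "s \<equiv> sqrt (card A)"
  shows "power_sum A a 1 ^ 3 + 3 * power_sum A a 1 + 2 * power_sum A a 3 \<le> s ^ 3 + 3 * s + 2 / s"
proof -
  define p where "p = power_sum A a"
  define t where "t = (s - p 1) * (2 / s + 1 / s\<^sup>2)"
  have s: "s \<ge> 1" using card_pos by (simp add: s_def)
  have p1: "1 \<le> p 1" "p 1 \<le> s"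
    using one_le_power_sum_1 power_sum_1_le by (auto simp: p_def s_def)
  have "1 / s \<le> 1" "1 / s\<^sup>2 \<le> 1" using s by (auto simp: divide_simps)
  moreover have "s\<^sup>2 \<ge> 1" "s * p 1 \<ge> 1" "(p 1)\<^sup>2 \<ge> 1"
    using s p1 by (auto intro: mult_ge1_I)
  ultimately have "2 * (2 / s + 1 / s\<^sup>2) \<le> s\<^sup>2 + s * p 1 + (p 1)\<^sup>2 + 3"
    by simp
  then have "(s - p 1) * (2 * (2 / s + 1 / s\<^sup>2)) \<le> (s - p 1) * (s\<^sup>2 + s * p 1 + (p 1)\<^sup>2 + 3)"
    using p1 by (intro mult_left_mono) auto
  also have "\<dots> = s ^ 3 - p 1 ^ 3 + 3 * (s - p 1)"
    by (simp add: power2_eq_square power3_eq_cube algebra_simps)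
  finally have "2 * t \<le> s ^ 3 - p 1 ^ 3 + 3 * (s - p 1)"
    by (simp only: t_def mult.left_commute)
  moreover have "2 * p 3 \<le> 2 / s + 2 * t"
    using power_sum_3_le by (simp add: p_def s_def t_def)
  ultimately show ?thesis
    unfolding p_def by argo
qed

lemma pair_sum_squares_diff_squared:
  "(\<Sum>i\<in>A. \<Sum>j\<in>A. ((a i)\<^sup>2 - (a j)\<^sup>2)\<^sup>2) = 2 * (real (card A) * power_sum A a 4 - 1)"
proof -
  have "power_sum A (\<lambda>i. (a i)\<^sup>2) 2 = power_sum A a 4"
    "power_sum A (\<lambda>i. (a i)\<^sup>2) 1 = power_sum A a 2"
    by (simp_all add: power_sum_def flip: power_mult)
  then show ?thesis
    using pair_sum_diff_squared[of "\<lambda>i. (a i)\<^sup>2" A] norm by simp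
qed

text \<open>
  For \<open>i \<noteq> j\<close> the common factor \<open>(a i - a j)\<^sup>2\<close> can be removed. With \<open>x = a i\<close> and \<open>y = a j\<close>,
  \<open>n \<ge> 2\<close> bounds the left coefficient by \<open>14 * (x * y) + 3 * (x\<^sup>2 + y\<^sup>2)\<close>, and \<open>(p 1)\<^sup>2 \<ge> (x + y)\<^sup>2\<close>
  leaves \<open>12 * (x * y) + 2 * (x\<^sup>2 + y\<^sup>2) \<le> 8 * (x\<^sup>2 + y\<^sup>2) \<le> 8\<close>. Equality holds throughout for \<open>n = 2\<close> and
  \<open>x = y\<close>, so the lower bound \<open>(x + y)\<^sup>2\<close> for \<open>(p 1)\<^sup>2\<close> cannot be replaced by \<open>1\<close>.
\<close>
lemma fourth_moment_pair_bound:
  assumes ij: "i \<in> A" "j \<in> A"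
  defines "n \<equiv> real (card A)"
  shows "8 * (a i * a j * (a i - a j)\<^sup>2) + 6 / n * ((a i)\<^sup>2 - (a j)\<^sup>2)\<^sup>2
    \<le> (n + (power_sum A a 1)\<^sup>2 + 6) * (a i - a j)\<^sup>2"
proof (cases "i = j")
  case False
  let ?x = "a i" and ?y = "a j" and ?p = "power_sum A a 1"
  have sub: "{i, j} \<subseteq> A" using ij by auto
  have "card {i, j} \<le> card A" using sub fin by (rule card_mono[rotated])
  then have n: "n \<ge> 2" using False by (simp add: n_def)
  have xy: "0 \<le> ?x" "0 \<le> ?y" using ij nonneg by auto
  have "(\<Sum>l\<in>{i,j}. a l ^ 2) \<le> power_sum A a 2"
    unfolding power_sum_def using sub fin by (intro sum_mono2) auto
  then have sq: "?x\<^sup>2 + ?y\<^sup>2 \<le> 1" using False norm by simp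
  have "(\<Sum>l\<in>{i,j}. a l ^ 1) \<le> ?p"
    unfolding power_sum_def using sub fin nonneg by (intro sum_mono2) auto
  then have "(?x + ?y)\<^sup>2 \<le> ?p\<^sup>2" using False xy by (intro power_mono) auto
  then have p: "?x\<^sup>2 + ?y\<^sup>2 + 2 * (?x * ?y) \<le> ?p\<^sup>2" by (simp add: power2_sum)
  have "0 \<le> (?x - ?y)\<^sup>2" by simp
  then have amgm: "2 * (?x * ?y) \<le> ?x\<^sup>2 + ?y\<^sup>2" by (simp add: power2_diff)
  have "6 / n * (?x + ?y)\<^sup>2 \<le> 3 * (?x + ?y)\<^sup>2"
    using n by (intro mult_right_mono) (auto simp: divide_simps)
  then have "8 * (?x * ?y) + 6 / n * (?x + ?y)\<^sup>2 \<le> n + ?p\<^sup>2 + 6"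
    using n sq p amgm by (simp add: power2_sum)
  then have "(8 * (?x * ?y) + 6 / n * (?x + ?y)\<^sup>2) * (?x - ?y)\<^sup>2 \<le> (n + ?p\<^sup>2 + 6) * (?x - ?y)\<^sup>2"
    by (rule mult_right_mono) simp
  moreover have "(?x\<^sup>2 - ?y\<^sup>2)\<^sup>2 = (?x + ?y)\<^sup>2 * (?x - ?y)\<^sup>2"
    by (simp add: power2_eq_square algebra_simps)
  ultimately show ?thesis by (simp add: algebra_simps)
qed simp

lemma fourth_moment_le:
  defines "n \<equiv> real (card A)"
  shows "power_sum A a 1 ^ 4 + 6 * power_sum A a 1 ^ 2 + 3
      + 8 * power_sum A a 1 * power_sum A a 3 + 6 * power_sum A a 4
    \<le> n\<^sup>2 + 6 * n + 11 + 6 / n"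
proof -
  define p where "p = power_sum A a"
  have n: "n > 0" using card_pos by (simp add: n_def)
  have "(\<Sum>i\<in>A. \<Sum>j\<in>A. 8 * (a i * a j * (a i - a j)\<^sup>2) + 6 / n * ((a i)\<^sup>2 - (a j)\<^sup>2)\<^sup>2)
      \<le> (\<Sum>i\<in>A. \<Sum>j\<in>A. (n + (p 1)\<^sup>2 + 6) * (a i - a j)\<^sup>2)"
    unfolding n_def p_def by (intro sum_mono fourth_moment_pair_bound)
  then have "8 * (2 * (p 1 * p 3 - 1)) + 6 / n * (2 * (n * p 4 - 1))
      \<le> (n + (p 1)\<^sup>2 + 6) * (2 * (n - (p 1)\<^sup>2))"
    unfolding sum.distrib sum_distrib_left[symmetric] pair_sum_diff_squared[of a]
      pair_sum_weighted_diff_squared pair_sum_squares_diff_squared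
    using norm by (simp add: p_def n_def)
  moreover have "6 / n * (2 * (n * p 4 - 1)) = 12 * p 4 - 12 / n"
    using n by (simp add: field_simps)
  moreover have "(n + (p 1)\<^sup>2 + 6) * (2 * (n - (p 1)\<^sup>2))
      = 2 * (n\<^sup>2 - p 1 ^ 4 + 6 * n - 6 * (p 1)\<^sup>2)"
    by (simp add: power2_eq_square power4_eq_xxxx algebra_simps)
  ultimately show ?thesis by (simp add: p_def)
qed

end

section \<open>Comparison of moments\<close>

theorem corollary4p2:
  fixes M :: "'w measure" and X :: "nat \<Rightarrow> 'w \<Rightarrow> real"
    and a :: "nat \<Rightarrow> real" and k n :: nat
  assumes "prob_space M"
    and "prob_space.indep_vars M (\<lambda>_. borel) X {1..}"
    and "\<And>i. i \<ge> 1 \<Longrightarrow> distributed M lborel (X i) (exponential_density 1)"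
    and "1 \<le> k" and "k \<le> 4"
    and "\<And>i. i \<in> {1..n} \<Longrightarrow> a i \<ge> 0"
    and "(\<Sum>i=1..n. (a i)\<^sup>2) = 1"
  shows "(\<integral>\<omega>. X 1 \<omega> ^ k \<partial>M) \<le> (\<integral>\<omega>. (\<Sum>j=1..n. a j * X j \<omega>) ^ k \<partial>M)
       \<and> (\<integral>\<omega>. (\<Sum>j=1..n. a j * X j \<omega>) ^ k \<partial>M)
            \<le> (\<integral>\<omega>. ((\<Sum>j=1..n. X j \<omega>) / sqrt (real n)) ^ k \<partial>M)"
proof -
  interpret prob_space M by fact
  let ?A = "{1..n}"
  define s where "s = sqrt (real n)"
  define p where "p = power_sum ?A a"
  define q where "q = power_sum ?A (\<lambda>_. 1 / s)"
  have indep: "indep_vars (\<lambda>_. borel) X ?A"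
    using assms(2) by (rule indep_vars_subset) auto
  have dist: "i \<in> ?A \<Longrightarrow> distributed M lborel (X i) (exponential_density 1)" for i
    using assms(3) by simp
  have norm: "power_sum ?A a 2 = 1"
    using assms(7) by (simp add: power_sum_def)
  note hyps = finite_atLeastAtMost assms(6) norm
  have "n \<ge> 1" using card_pos[OF hyps] by simp
  then have s: "s > 0" and s2: "s\<^sup>2 = n" by (auto simp: s_def)
  then have s4: "s ^ 4 = (real n)\<^sup>2" by (metis power4_eq_xxxx power2_eq_square mult.assoc)
  have q_power: "q r = s\<^sup>2 * (1 / s) ^ r" for r
    by (simp add: q_def power_sum_def s2)
  have q: "q 1 = s" "q 2 = 1" "q 3 = 1 / s" "q 4 = 1 / s\<^sup>2"
    unfolding q_power using s
    by (simp_all add: field_simps power2_eq_square power3_eq_cube power4_eq_xxxx)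
  have X: "expectation (\<lambda>\<omega>. X 1 \<omega> ^ r) = fact r" for r
    using erlang_ith_moment[OF _ assms(3), of 1 r] by simp
  have avg: "(\<Sum>j=1..n. X j \<omega>) / sqrt (real n) = (\<Sum>j=1..n. 1 / s * X j \<omega>)" for \<omega>
    by (simp add: s_def sum_divide_distrib)
  note S = moments_exponential_sum[OF finite_atLeastAtMost indep dist, of a, folded p_def]
  note T = moments_exponential_sum[OF finite_atLeastAtMost indep dist, of "\<lambda>_. 1 / s", folded q_def,
      unfolded q]
  have p1: "1 \<le> p 1" "p 1 \<le> s" "(p 1)\<^sup>2 \<le> n" and p2: "p 2 = 1"
    using one_le_power_sum_1[OF hyps] power_sum_1_le[OF hyps] power_sum_1_squared_le[OF hyps] norm
    by (auto simp: p_def s_def)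
  have p1_2: "1 \<le> (p 1)\<^sup>2" using p1 by simp
  note b3 = third_moment_ge[OF hyps, folded p_def] third_moment_le[OF hyps, folded p_def]
  note b4 = fourth_moment_ge[OF hyps, folded p_def] fourth_moment_le[OF hyps, folded p_def]
  from \<open>1 \<le> k\<close> \<open>k \<le> 4\<close> consider "k = 1" | "k = 2" | "k = 3" | "k = 4" by linarith
  then show ?thesis
  proof cases
    case 1
    show ?thesis unfolding 1 avg X using S T p1 by simp
  next
    case 2
    show ?thesis unfolding 2 avg X using S T p1 p1_2 p2 s2 by (simp add: fact_numeral)
  next
    case 3
    show ?thesis unfolding 3 avg X using S T b3 p2 by (simp add: s_def fact_numeral)
  next
    case 4
    show ?thesis unfolding 4 avg X using S T b4 p2 s s2 s4 by (simp add: fact_numeral)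
  qed
qed

end
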